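(* Let $q\in(1,2_\theta^*]$ with $q<\infty$. For each admissible space step $h$ let $\mathbf u^0=\mathbf u^0_h\in\mathbb R^{\mathbb Z}$ with $(\mathbf u^0_h)_i=0$ for $|i|>M_x$ and $\mathbf u^0_h\not\equiv0$, and assume that $\|\mathbf u^0_h\|_{\ell^q_h(\mathbb R)}$ converges as $h\to0$. Let $C>0$ be any constant such that $\|\mathbf f\|_{\ell^q_h(\mathbb R)}\le C\|\mathbf f\|_{\mathcal X^\theta_h(I)}$ for every admissible $h$ and every $\mathbf f\in\mathcal X^\theta_h(I)$. For $\Delta t>0$ and $h$ admissible, let $(\mathbf u^n)_{n\in\mathbb N}$ be the solution of the fully discrete scheme with initial datum $\mathbf u^0_h$. (1) If $q\ne2$, then for all $\varepsilon>0$ there exists $\Delta t_0>0$ such that for every admissible $h$, every $\Delta t<\Delta t_0$ and every $n\ge0$, $$\|\mathbf u^n\|_{\ell^q_h(\mathbb R)}\le\left(\|\mathbf u^0\|_{\ell^q_h(\mathbb R)}^{-(2-q)}+\frac{2-q}{q-1}C^{-2}n\Delta t\right)_+^{\frac{-1}{2-q}}+\varepsilon .$$ In particular, if $\|\mathbf u^0_h\|_{\ell^q_h(\mathbb R)}\to\|u^0\|_{L^q(I)}$ as $h\to 0$ for some $u^0\in L^q(I)$, $u^0\not\equiv 0$, then for each $t\ge0$ the right-hand side converges to $\left(\|u^0\|_{L^q(I)}^{-(2-q)}+\frac{2-q}{q-1}C^{-2}t\right)_+^{\frac{-1}{2-q}}$ as $(\Delta t,h)\to0$, $\varepsilon\to0$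 and $n\Delta t\to t$. (2) If $q>2$, let $T_*^h:=\frac{q-1}{q-2}C^2\|\mathbf u^0\|_{\ell^q_h(\mathbb R)}^{q-2}$. Then for every $n\ge0$ (the last factor being read as $1$ when $n=0$), $$\|\mathbf u^n\|_{\ell^q_h(\mathbb R)}\le\|\mathbf u^0\|_{\ell^q_h(\mathbb R)}\left(\frac{T_*^h}{n\Delta t}\right)^{n/2}.$$
   Context: Fix $\theta\in(0,1)$, $L>0$, $I=(-L,L)$. $2_\theta^*:=2/(1-2\theta)_+$, equal to $+\infty$ if $2\theta\ge1$; $a_+:=\max(a,0)$. A space step $h>0$ is admissible if $L=(M_x+1)h$ for some integer $M_x\ge1$. Bold letters denote elements of $\mathbb R^{\mathbb Z}$. Powers of possibly negative quantities are odd powers: $a^{s}:=|a|^{s-1}a$ for $a\ne0$, $s>0$, and $0^s:=0$. Weights: let $C_{1,\theta}=\left(\int_{\mathbb R}\frac{1-\cos\xi}{|\xi|^{1+2\theta}}d\xi\right)^{-1}$ and, for $t>0$, $G(t)=\frac{C_{1,\theta}}{(2-2\theta)(2\theta-1)2\theta}t^{2-2\theta}$ if $2\theta\ne1$, $G(t)=C_{1,\theta}(t-t\log t)$ if $2\theta=1$. The weights are symmetric, $w^h_{-j}=w^h_j$, with $w_0^h:=0$ (its value plays no role) and for $j\ge1$: $w_1^h=h^{-2\theta}\left[\frac{C_{1,\theta}}{2-2\theta}-G''(1)-\frac{G'(3)+3G'(1)}2+G(3)-G(1)\right]$; $w^h_j=2h^{-2\theta}[G'(j+1)+G'(j-1)-G(j+1)+G(j-1)]$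 for $j$ even; $w_j^h=h^{-2\theta}\left[-\frac{G'(j+2)+6G'(j)+G'(j-2)}2+G(j+2)-G(j-2)\right]$ for $j\ge3$ odd. (Known fact: there are constants $b_\theta,B_\theta>0$ depending only on $\theta$ with $b_\theta h|jh|^{-1-2\theta}\le w_j^h\le B_\theta h|jh|^{-1-2\theta}$ for $j\neq0$.) Discrete fractional Laplacian: $[(-\Delta)^\theta_h\mathbf f]_i=\sum_{j\in\mathbb Z}w_j^h(f_i-f_{i-j})$. Norms: $\|\mathbf f\|_{\ell^q_h(\mathbb R)}=\left(\sum_{i\in\mathbb Z}h|f_i|^q\right)^{1/q}$; $\mathcal X^\theta_h(I)=\{\mathbf f\in\mathbb R^{\mathbb Z}: f_i=0\text{ for }|i|>M_x\}$ with $\|\mathbf f\|_{\mathcal X^\theta_h(I)}=\left(\frac12\sum_{i,j\in\mathbb Z}h\,w_j^h|f_i-f_{i-j}|^2\right)^{1/2}$. Fully discrete scheme with initial datum $\mathbf u^0$ and time step $\Delta t>0$: the unique $\mathbf u^n=(u_i^n)_{i\in\mathbb Z}$, $n\in\mathbb N$, such that $\frac{(u_i^{n+1})^{q-1}-(u_i^n)^{q-1}}{\Delta t}+[(-\Delta)^\theta_h\mathbf u^{n+1}]_i=0$ for $|i|\le M_x$, $n\ge0$; $u_i^n=0$ for $|i|\ge M_x+1$, $n\ge0$; $u_i^0=(\mathbf u^0)_i$ for $|i|\le M_x$ (existence and uniqueness hold). *)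

theory Defs
  imports "HOL-Analysis.Analysis"
begin

text \<open>Grid functions are functions \<open>int \<Rightarrow> real\<close>; sums over the grid are unordered
  infinite sums.\<close>

definition crit_exp :: "real \<Rightarrow> ereal" where
  "crit_exp \<theta> = (if 2 * \<theta> \<ge> 1 then \<infinity> else ereal (2 / (1 - 2 * \<theta>)))"

definition admissible :: "real \<Rightarrow> real \<Rightarrow> bool" where
  "admissible L h \<longleftrightarrow> h > 0 \<and> (\<exists>M::nat. M \<ge> 1 \<and> L = (real M + 1) * h)"

text \<open>The number \<open>M\<^sub>x\<close> of the mesh; meaningful for admissible \<open>h\<close> only, where it is unique.\<close>
definition mesh_num :: "real \<Rightarrow> real \<Rightarrow> nat" where
  "mesh_num L h = (THE M::nat. M \<ge> 1 \<and> L = (real M + 1) * h)"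

text \<open>The odd power \<open>\<bar>a\<bar>\<^bsup>s-1\<^esup> a\<close>, used for \<open>s > 0\<close>.\<close>
definition odd_powr :: "real \<Rightarrow> real \<Rightarrow> real" where
  "odd_powr a s = (if a = 0 then 0 else \<bar>a\<bar> powr (s - 1) * a)"

definition frac_const :: "real \<Rightarrow> real" where
  "frac_const \<theta> = inverse (LINT \<xi>|lborel. (1 - cos \<xi>) / \<bar>\<xi>\<bar> powr (1 + 2 * \<theta>))"

text \<open>Only the values for \<open>t > 0\<close> matter: \<open>G\<close> and its derivatives are evaluated at
  points \<open>\<ge> 1\<close> in the weights below.\<close>
definition G :: "real \<Rightarrow> real \<Rightarrow> real" where
  "G \<theta> t =
     (if 2 * \<theta> = 1 then frac_const \<theta> * (t - t * ln t)
      else frac_const \<theta> / ((2 - 2 * \<theta>) * (2 * \<theta> - 1) * (2 * \<theta>)) * t powr (2 - 2 * \<theta>))"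

definition weight :: "real \<Rightarrow> real \<Rightarrow> int \<Rightarrow> real" where
  "weight \<theta> h j =
     (let k = \<bar>j\<bar>; x = real_of_int k; G0 = G \<theta>; G1 = deriv G0; G2 = deriv G1 in
      if k = 0 then 0
      else if k = 1 then
        h powr (- 2 * \<theta>) *
          (frac_const \<theta> / (2 - 2 * \<theta>) - G2 1 - (G1 3 + 3 * G1 1) / 2 + G0 3 - G0 1)
      else if even k then
        2 * h powr (- 2 * \<theta>) * (G1 (x + 1) + G1 (x - 1) - G0 (x + 1) + G0 (x - 1))
      else
        h powr (- 2 * \<theta>) *
          (- (G1 (x + 2) + 6 * G1 x + G1 (x - 2)) / 2 + G0 (x + 2) - G0 (x - 2)))"

definition frac_lap :: "real \<Rightarrow> real \<Rightarrow> (int \<Rightarrow> real) \<Rightarrow> int \<Rightarrow> real" where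
  "frac_lap \<theta> h f i = (\<Sum>\<^sub>\<infinity>j\<in>UNIV. weight \<theta> h j * (f i - f (i - j)))"

definition lq_norm :: "real \<Rightarrow> real \<Rightarrow> (int \<Rightarrow> real) \<Rightarrow> real" where
  "lq_norm q h f = (\<Sum>\<^sub>\<infinity>i\<in>UNIV. h * \<bar>f i\<bar> powr q) powr (1 / q)"

definition X_space :: "real \<Rightarrow> real \<Rightarrow> (int \<Rightarrow> real) set" where
  "X_space L h = {f. \<forall>i. \<bar>i\<bar> > int (mesh_num L h) \<longrightarrow> f i = 0}"

definition X_norm :: "real \<Rightarrow> real \<Rightarrow> (int \<Rightarrow> real) \<Rightarrow> real" where
  "X_norm \<theta> h f =
     sqrt (1 / 2 * (\<Sum>\<^sub>\<infinity>(i, j)\<in>UNIV. h * weight \<theta> h j * \<bar>f i - f (i - j)\<bar>\<^sup>2))"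

definition scheme_solution ::
  "real \<Rightarrow> real \<Rightarrow> real \<Rightarrow> real \<Rightarrow> real \<Rightarrow> (int \<Rightarrow> real) \<Rightarrow> (nat \<Rightarrow> int \<Rightarrow> real) \<Rightarrow> bool" where
  "scheme_solution \<theta> L q h dt u0 u \<longleftrightarrow>
     (\<forall>n i. \<bar>i\<bar> \<le> int (mesh_num L h) \<longrightarrow>
        (odd_powr (u (Suc n) i) (q - 1) - odd_powr (u n i) (q - 1)) / dt
          + frac_lap \<theta> h (u (Suc n)) i = 0) \<and>
     (\<forall>n i. \<bar>i\<bar> \<ge> int (mesh_num L h) + 1 \<longrightarrow> u n i = 0) \<and>
     (\<forall>i. \<bar>i\<bar> \<le> int (mesh_num L h) \<longrightarrow> u 0 i = u0 i)"

text \<open>Elements of \<open>L\<^sup>q(A)\<close> are represented by Lebesgue measurable functions; being nonzero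
  in \<open>L\<^sup>q(A)\<close> means not vanishing almost everywhere on \<open>A\<close>.\<close>
definition in_Lq :: "real \<Rightarrow> real set \<Rightarrow> (real \<Rightarrow> real) \<Rightarrow> bool" where
  "in_Lq q A f \<longleftrightarrow>
     set_borel_measurable lebesgue A f \<and> set_integrable lebesgue A (\<lambda>x. \<bar>f x\<bar> powr q)"

definition Lq_norm :: "real \<Rightarrow> real set \<Rightarrow> (real \<Rightarrow> real) \<Rightarrow> real" where
  "Lq_norm q A f = (LINT x:A|lebesgue. \<bar>f x\<bar> powr q) powr (1 / q)"

definition decay_bound :: "real \<Rightarrow> real \<Rightarrow> real \<Rightarrow> real \<Rightarrow> real" where
  "decay_bound q C N s =
     (max (N powr (- (2 - q)) + (2 - q) / (q - 1) * inverse (C\<^sup>2) * s) 0) powr (- 1 / (2 - q))"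

text \<open>The regime \<open>(\<Delta>t, h) \<rightarrow> 0\<close>, \<open>\<epsilon> \<rightarrow> 0\<close>, \<open>n \<Delta>t \<rightarrow> t\<close>, over positive \<open>\<Delta>t\<close> and \<open>\<epsilon>\<close> and
  admissible \<open>h\<close>, as a filter on tuples \<open>(\<Delta>t, h, \<epsilon>, n)\<close>.\<close>
definition refinement_filter :: "real \<Rightarrow> real \<Rightarrow> (real \<times> real \<times> real \<times> nat) filter" where
  "refinement_filter L t =
     inf (filtercomap (\<lambda>(dt, h, \<epsilon>, n). (dt, h, \<epsilon>, real n * dt)) (nhds (0, 0, 0, t)))
         (principal {(dt, h, \<epsilon>, n). dt > 0 \<and> admissible L h \<and> \<epsilon> > 0})"

definition ext_time :: "real \<Rightarrow> real \<Rightarrow> real \<Rightarrow> real" where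
  "ext_time q C N = (q - 1) / (q - 2) * C\<^sup>2 * N powr (q - 2)"

end

theory Submission
  imports Defs
begin

text \<open>Testing the scheme with the new iterate, Hoelder's inequality and the embedding give
  \<open>N\<^sub>n\<^sub>+\<^sub>1\<^bsup>q-1\<^esup> + \<Delta>t C\<^bsup>-2\<^esup> N\<^sub>n\<^sub>+\<^sub>1 \<le> N\<^sub>n\<^bsup>q-1\<^esup>\<close> for the norms \<open>N\<^sub>n\<close>, the implicit Euler scheme for
  \<open>(N\<^bsup>q-1\<^esup>)' = - C\<^bsup>-2\<^esup> N\<close>. Its exact solution \<open>D\<close> is \<open>decay_bound\<close>, and \<open>D\<^bsup>q-1\<^esup>\<close> lies above its
  tangents, so the scheme exceeds it by at most \<open>\<Delta>t C\<^bsup>-2\<^esup> N\<^sub>0\<close> after any number of steps. For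
  \<open>q > 2\<close>, concavity of \<open>v \<mapsto> v\<^bsup>(q-2)/(q-1)\<^esup>\<close> gives
  \<open>N\<^sub>k\<^bsup>q-2\<^esup> - N\<^sub>k\<^sub>+\<^sub>1\<^bsup>q-2\<^esup> \<ge> (q-2)/(q-1) C\<^bsup>-2\<^esup> \<Delta>t N\<^sub>k\<^sub>+\<^sub>1/N\<^sub>k\<close>; summing over \<open>k\<close> and applying the AM-GM
  inequality to the ratios, whose product telescopes, yields even the exponent \<open>n\<close> in place
  of \<open>n/2\<close> once \<open>n \<Delta>t \<ge> T\<^sub>*\<close>.\<close>

section \<open>Tangent inequalities for powers and Hoelder's inequality\<close>

lemma convex_on_powr:
  fixes r :: real
  assumes "r \<le> 0 \<or> 1 \<le> r"
  shows "convex_on {0<..} (\<lambda>x. x powr r)"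
proof -
  have "0 \<le> r * (r - 1)"
    using assms by (auto intro: mult_nonneg_nonneg mult_nonpos_nonpos)
  hence "0 \<le> r * ((r - 1) * x powr (r - 1 - 1))" for x :: real
    by (simp flip: mult.assoc)
  thus ?thesis
    by (intro f''_ge0_imp_convex[where f' = "\<lambda>x. r * x powr (r - 1)"
          and f'' = "\<lambda>x. r * ((r - 1) * x powr (r - 1 - 1))"])
       (auto intro!: derivative_eq_intros)
qed

lemma powr_above_tangent:
  fixes x y r :: real
  assumes "r \<le> 0 \<or> 1 \<le> r" "0 < x" "0 < y"
  shows "x powr r + r * x powr (r - 1) * (y - x) \<le> y powr r"
proof -
  have "r * x powr (r - 1) * (y - x) \<le> y powr r - x powr r"
    using assms
    by (intro convex_on_imp_above_tangent[OF convex_on_powr[OF assms(1)]])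
       (auto simp: interior_open intro!: derivative_eq_intros)
  thus ?thesis by simp
qed

text \<open>Weighted AM-GM gives y^r x^(1-r) <= r y + (1-r) x; multiplying by x^(r-1) turns this
  into the concavity inequality.\<close>

lemma powr_below_tangent:
  fixes x y r :: real
  assumes "0 \<le> r" "r \<le> 1" "0 < x" "0 < y"
  shows "y powr r \<le> x powr r + r * x powr (r - 1) * (y - x)"
proof -
  have "y powr r = y powr r * x powr (1 - r) * x powr (r - 1)"
    using assms by (simp flip: powr_add add: mult.assoc)
  also have "\<dots> \<le> (r * y + (1 - r) * x) * x powr (r - 1)"
    using Youngs_inequality_0[of r "1 - r" y x] assms by (intro mult_right_mono) auto
  also have "\<dots> = x * x powr (r - 1) + r * x powr (r - 1) * (y - x)"
    by (simp add: algebra_simps)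
  also have "x * x powr (r - 1) = x powr r"
    using assms powr_add[of x 1 "r - 1"] by simp
  finally show ?thesis .
qed

text \<open>After normalising both sums to 1, Young's inequality applies termwise; vanishing terms
  are split off because it needs positive arguments. The exponents a and b are the reciprocals of
  the conjugate exponents, so that summands h |f_i|^q can be inserted as they are.\<close>

lemma Holder_sum_powr:
  fixes x y :: "'a \<Rightarrow> real"
  assumes "finite A" "0 < a" "0 < b" "a + b = 1"
    and "\<And>i. i \<in> A \<Longrightarrow> 0 \<le> x i" "\<And>i. i \<in> A \<Longrightarrow> 0 \<le> y i"
  shows "(\<Sum>i\<in>A. x i powr a * y i powr b) \<le> (\<Sum>i\<in>A. x i) powr a * (\<Sum>i\<in>A. y i) powr b"
proof (cases "(\<Sum>i\<in>A. x i) = 0 \<or> (\<Sum>i\<in>A. y i) = 0")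
  case True
  hence "x i powr a * y i powr b = 0" if "i \<in> A" for i
    using that assms by (auto simp: sum_nonneg_eq_0_iff)
  hence "(\<Sum>i\<in>A. x i powr a * y i powr b) = 0"
    by (intro sum.neutral) blast
  thus ?thesis by simp
next
  case False
  define X Y where "X = (\<Sum>i\<in>A. x i)" and "Y = (\<Sum>i\<in>A. y i)"
  have pos: "0 < X" "0 < Y"
    using False assms unfolding X_def Y_def
    by (metis less_eq_real_def sum_nonneg)+
  have "x i powr a * y i powr b \<le> X powr a * Y powr b * (a * (x i / X) + b * (y i / Y))"
    if "i \<in> A" for i
  proof (cases "x i = 0 \<or> y i = 0")
    case True
    thus ?thesis using that assms pos by auto
  next
    case False
    hence "0 < x i" "0 < y i" using that assms(5,6)[of i] by auto
    hence "(x i / X) powr a * (y i / Y) powr b \<le> a * (x i / X) + b * (y i / Y)"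
      using assms pos by (intro Youngs_inequality_0) auto
    hence "X powr a * Y powr b * ((x i / X) powr a * (y i / Y) powr b)
        \<le> X powr a * Y powr b * (a * (x i / X) + b * (y i / Y))"
      by (intro mult_left_mono) auto
    thus ?thesis
      using pos \<open>0 < x i\<close> \<open>0 < y i\<close> by (simp add: powr_divide field_simps)
  qed
  hence "(\<Sum>i\<in>A. x i powr a * y i powr b)
      \<le> (\<Sum>i\<in>A. X powr a * Y powr b * (a * (x i / X) + b * (y i / Y)))"
    by (intro sum_mono)
  also have "\<dots> = X powr a * Y powr b * (a * ((\<Sum>i\<in>A. x i) / X) + b * ((\<Sum>i\<in>A. y i) / Y))"
    by (simp add: sum_distrib_left sum_divide_distrib sum.distrib distrib_left)
  also have "\<dots> = X powr a * Y powr b"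
    using pos assms(4) unfolding X_def[symmetric] Y_def[symmetric] by simp
  finally show ?thesis by (simp add: X_def Y_def)
qed

section \<open>Summation by parts for the discrete Dirichlet form\<close>

text \<open>The product is a disjoint union of finitely many slices \<open>{i} \<times> B\<close>,
  so finite additivity of \<open>has_sum\<close> suffices.\<close>

lemma has_sum_Times_finite:
  fixes g :: "'a \<Rightarrow> 'b \<Rightarrow> 'c :: topological_comm_monoid_add"
  assumes "finite A" "\<And>i. i \<in> A \<Longrightarrow> (g i has_sum s i) B"
  shows "((\<lambda>(i, j). g i j) has_sum sum s A) (A \<times> B)"
proof -
  have "((\<lambda>(i, j). g i j) has_sum sum s A) (\<Union>i\<in>A. {i} \<times> B)"
  proof (rule sum_has_sum[OF assms(1)])
    fix i assume "i \<in> A"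
    have "bij_betw (Pair i) B ({i} \<times> B)"
      by (auto simp: bij_betw_def inj_on_def)
    from has_sum_reindex_bij_betw[OF this, of "\<lambda>(i, j). g i j"]
    show "((\<lambda>(i, j). g i j) has_sum s i) ({i} \<times> B)"
      using assms(2)[OF \<open>i \<in> A\<close>] by simp
  qed auto
  moreover have "(\<Union>i\<in>A. {i} \<times> B) = A \<times> B" by auto
  ultimately show ?thesis by simp
qed

lemma summable_on_finite_support_diff:
  fixes w f :: "int \<Rightarrow> real"
  assumes w: "w summable_on UNIV" and A: "finite A" "\<And>i. i \<notin> A \<Longrightarrow> f i = 0"
  shows "(\<lambda>j. w j * f (i - j)) summable_on UNIV"
proof -
  have "(\<lambda>j. w j * f (i - j)) summable_on ((\<lambda>k. i - k) ` A)"
    using A by simp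
  also have "?this \<longleftrightarrow> ?thesis"
  proof (rule summable_on_cong_neutral)
    fix j assume "j \<in> UNIV - (\<lambda>k. i - k) ` A"
    hence "i - j \<notin> A" by (metis DiffD2 diff_diff_eq2 add_diff_cancel_left' image_eqI)
    thus "w j * f (i - j) = 0" using A by simp
  qed auto
  finally show ?thesis .
qed

text \<open>Expanding the square leaves two square terms and a cross term. The bijection (i, j) ->
  (i - j, j) shows that the square terms have equal sums, which produces the factor 2. Each of the
  three double sums converges because f has finite support and w is summable.\<close>

lemma has_sum_dirichlet_form:
  fixes w f :: "int \<Rightarrow> real"
  assumes w: "w summable_on UNIV" and A: "finite A" "\<And>i. i \<notin> A \<Longrightarrow> f i = 0"
  shows "((\<lambda>(i, j). w j * (f i - f (i - j))\<^sup>2) has_sum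
           2 * (\<Sum>i\<in>A. f i * (\<Sum>\<^sub>\<infinity>j. w j * (f i - f (i - j))))) UNIV"
proof -
  define W where "W = infsum w UNIV"
  define K where "K i = (\<Sum>\<^sub>\<infinity>j. w j * f (i - j))" for i
  have W: "(w has_sum W) UNIV"
    using w by (simp add: W_def)
  have K: "((\<lambda>j. w j * f (i - j)) has_sum K i) UNIV" for i
    unfolding K_def by (intro has_sum_infsum summable_on_finite_support_diff[OF w A])
  have supp: "i \<in> A" if "f i \<noteq> 0" for i
    using A(2) that by blast
  \<comment> \<open>The factor f i confines the sum over the whole plane to the strip
    \<open>A \<times> UNIV\<close>, where only finitely many rows remain.\<close>
  have extend: "((\<lambda>(i, j). f i * g i j) has_sum s) (UNIV :: (int \<times> int) set)"
    if "((\<lambda>(i, j). f i * g i j) has_sum s) (A \<times> UNIV)" for g s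
    using that
    by (subst has_sum_cong_neutral[where T = "A \<times> UNIV" and g = "\<lambda>(i, j). f i * g i j"])
       (auto dest: supp)
  have diag: "((\<lambda>(i, j). f i * (f i * w j)) has_sum (\<Sum>i\<in>A. f i * (f i * W))) UNIV"
    by (intro extend has_sum_Times_finite A has_sum_cmult_right W)
  have cross: "((\<lambda>(i, j). f i * (w j * f (i - j))) has_sum (\<Sum>i\<in>A. f i * K i)) UNIV"
    by (intro extend has_sum_Times_finite A has_sum_cmult_right K)
  have shifted: "((\<lambda>(i, j). f (i - j) * (f (i - j) * w j)) has_sum (\<Sum>i\<in>A. f i * (f i * W))) UNIV"
    using diag
    by (subst has_sum_reindex_bij_witness[where i = "\<lambda>(i, j). (i + j, j)"
          and j = "\<lambda>(i, j). (i - j, j)" and T = UNIV]) auto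
  have L: "(\<Sum>\<^sub>\<infinity>j. w j * (f i - f (i - j))) = f i * W - K i" for i
    using has_sum_add[OF has_sum_cmult_right[OF W, of "f i"] has_sum_cmult_right[OF K[of i], of "-1"]]
    by (intro infsumI) (simp add: algebra_simps)
  have "((\<lambda>x. (case x of (i, j) \<Rightarrow> f i * (f i * w j))
        + (case x of (i, j) \<Rightarrow> f (i - j) * (f (i - j) * w j))
        + (- 2) * (case x of (i, j) \<Rightarrow> f i * (w j * f (i - j))))
      has_sum (\<Sum>i\<in>A. f i * (f i * W)) + (\<Sum>i\<in>A. f i * (f i * W))
        + (- 2) * (\<Sum>i\<in>A. f i * K i)) UNIV"
    by (intro has_sum_add has_sum_cmult_right diag shifted cross)
  also have "(\<lambda>x. (case x of (i, j) \<Rightarrow> f i * (f i * w j))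
        + (case x of (i, j) \<Rightarrow> f (i - j) * (f (i - j) * w j))
        + (- 2) * (case x of (i, j) \<Rightarrow> f i * (w j * f (i - j))))
      = (\<lambda>(i, j). w j * (f i - f (i - j))\<^sup>2)"
    by (auto simp: fun_eq_iff power2_eq_square algebra_simps)
  also have "(\<Sum>i\<in>A. f i * (f i * W)) + (\<Sum>i\<in>A. f i * (f i * W)) + (- 2) * (\<Sum>i\<in>A. f i * K i)
      = 2 * (\<Sum>i\<in>A. f i * (\<Sum>\<^sub>\<infinity>j. w j * (f i - f (i - j))))"
    unfolding L by (simp add: right_diff_distrib sum_subtractf)
  finally show ?thesis .
qed

section \<open>Discrete norms and their decay in one time step\<close>

lemma lq_norm_nonneg: "0 \<le> lq_norm q h f"
  by (simp add: lq_norm_def)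

lemma lq_norm_powr:
  assumes "0 < q" "0 \<le> h" "finite A" "\<And>i. i \<notin> A \<Longrightarrow> f i = 0"
  shows "lq_norm q h f powr q = (\<Sum>i\<in>A. h * \<bar>f i\<bar> powr q)"
proof -
  have "(\<Sum>\<^sub>\<infinity>i\<in>UNIV. h * \<bar>f i\<bar> powr q) = (\<Sum>\<^sub>\<infinity>i\<in>A. h * \<bar>f i\<bar> powr q)"
    using assms(4) by (intro infsum_cong_neutral) auto
  also have "\<dots> = (\<Sum>i\<in>A. h * \<bar>f i\<bar> powr q)"
    using assms(3) by simp
  finally have eq: "(\<Sum>\<^sub>\<infinity>i\<in>UNIV. h * \<bar>f i\<bar> powr q) = (\<Sum>i\<in>A. h * \<bar>f i\<bar> powr q)" .
  have "0 \<le> (\<Sum>i\<in>A. h * \<bar>f i\<bar> powr q)"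
    using assms by (intro sum_nonneg) auto
  thus ?thesis
    using assms(1) by (simp add: lq_norm_def eq powr_powr)
qed

lemma lq_norm_pos:
  assumes "0 < q" "0 < h" "finite A" "\<And>i. i \<notin> A \<Longrightarrow> f i = 0" "f \<noteq> (\<lambda>_. 0)"
  shows "0 < lq_norm q h f"
proof -
  obtain k where k: "f k \<noteq> 0" using assms(5) by auto
  hence "k \<in> A" using assms(4) by blast
  have "0 < h * \<bar>f k\<bar> powr q" using k assms by simp
  also have "\<dots> \<le> (\<Sum>i\<in>A. h * \<bar>f i\<bar> powr q)"
    using assms \<open>k \<in> A\<close> by (intro member_le_sum) auto
  also have "\<dots> = lq_norm q h f powr q"
    using lq_norm_powr[of q h A f] assms by simp
  finally show ?thesis
    using lq_norm_nonneg[of q h f] by (cases "lq_norm q h f = 0") auto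
qed

text \<open>The junk value 0 of a divergent sum would make the right-hand side vanish, so any embedding
  inequality for the unit vector forces the weights to be summable.\<close>
lemma weight_summable:
  fixes \<delta> :: "int \<Rightarrow> real"
  defines "\<delta> \<equiv> (\<lambda>i. of_bool (i = 0))"
  assumes "0 < q" "0 < h" "lq_norm q h \<delta> \<le> C * X_norm \<theta> h \<delta>"
  shows "weight \<theta> h summable_on UNIV"
proof -
  let ?F = "\<lambda>(i, j). h * weight \<theta> h j * \<bar>\<delta> i - \<delta> (i - j)\<bar>\<^sup>2"
  have "\<delta> 0 \<noteq> 0" by (simp add: \<delta>_def)
  hence "0 < lq_norm q h \<delta>"
    using assms by (intro lq_norm_pos[of q h "{0}"]) (auto simp: \<delta>_def fun_eq_iff)
  hence "X_norm \<theta> h \<delta> \<noteq> 0" using assms(4) by auto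
  hence "infsum ?F UNIV \<noteq> 0" by (auto simp: X_norm_def)
  hence "?F summable_on UNIV" using infsum_not_exists by blast
  \<comment> \<open>In the row i = 0 the entries with j \<noteq> 0 are h times the weights, since
    \<delta> is 1 at 0 and 0 at -j.\<close>
  hence "?F summable_on Pair 0 ` (UNIV - {0})" by (rule summable_on_subset) simp
  also have "?this \<longleftrightarrow> (?F \<circ> Pair 0) summable_on (UNIV - {0})"
    by (intro summable_on_reindex) (auto simp: inj_on_def)
  also have "\<dots> \<longleftrightarrow> (\<lambda>j. h * weight \<theta> h j) summable_on (UNIV - {0})"
    by (intro summable_on_cong) (auto simp: \<delta>_def)
  also have "\<dots> \<longleftrightarrow> weight \<theta> h summable_on (UNIV - {0})"
    using assms(3) by (simp add: summable_on_cmult_right')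
  also have "\<dots> \<longleftrightarrow> weight \<theta> h summable_on UNIV"
    by (intro summable_on_cong_neutral) (auto simp: weight_def)
  finally show ?thesis .
qed

text \<open>The factor 1/2 in the norm cancels the 2 of the Dirichlet form. As \<open>sqrt\<close>
  of a negative number is negative, a nonnegative norm means a nonnegative radicand, and squaring
  then removes the root.\<close>

lemma X_norm_power2:
  assumes "weight \<theta> h summable_on UNIV" "finite A" "\<And>i. i \<notin> A \<Longrightarrow> f i = 0"
    and "0 \<le> X_norm \<theta> h f"
  shows "(X_norm \<theta> h f)\<^sup>2 = h * (\<Sum>i\<in>A. f i * frac_lap \<theta> h f i)"
proof -
  let ?E = "\<Sum>i\<in>A. f i * frac_lap \<theta> h f i"
  have "((\<lambda>x. h * (case x of (i, j) \<Rightarrow> weight \<theta> h j * (f i - f (i - j))\<^sup>2)) has_sum h * (2 * ?E)) UNIV"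
    unfolding frac_lap_def
    by (intro has_sum_cmult_right has_sum_dirichlet_form assms(1-3))
  also have "(\<lambda>x. h * (case x of (i, j) \<Rightarrow> weight \<theta> h j * (f i - f (i - j))\<^sup>2))
      = (\<lambda>(i, j). h * weight \<theta> h j * \<bar>f i - f (i - j)\<bar>\<^sup>2)"
    by (auto simp: fun_eq_iff)
  finally have "(\<Sum>\<^sub>\<infinity>(i, j)\<in>UNIV. h * weight \<theta> h j * \<bar>f i - f (i - j)\<bar>\<^sup>2) = h * (2 * ?E)"
    by (rule infsumI)
  hence "X_norm \<theta> h f = sqrt (h * ?E)"
    by (simp add: X_norm_def)
  thus ?thesis using assms(4) by auto
qed

lemma abs_odd_powr: "\<bar>odd_powr x s\<bar> = \<bar>x\<bar> powr s"
  using powr_add[of "\<bar>x\<bar>" "s - 1" 1] by (auto simp: odd_powr_def abs_mult)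

lemma norm_decay_step:
  fixes f g :: "int \<Rightarrow> real"
  assumes q: "1 < q" and h: "0 < h" and dt: "0 < dt" and C: "0 < C"
    and A: "finite A" "\<And>i. i \<notin> A \<Longrightarrow> f i = 0" "\<And>i. i \<notin> A \<Longrightarrow> g i = 0"
    and w: "weight \<theta> h summable_on UNIV"
    and emb: "lq_norm q h g \<le> C * X_norm \<theta> h g"
    and eq: "\<And>i. i \<in> A \<Longrightarrow>
      (odd_powr (g i) (q - 1) - odd_powr (f i) (q - 1)) / dt + frac_lap \<theta> h g i = 0"
  shows "lq_norm q h g powr (q - 1) + dt / C\<^sup>2 * lq_norm q h g \<le> lq_norm q h f powr (q - 1)"
proof (cases "lq_norm q h g = 0")
  case True
  thus ?thesis using q by simp
next
  case False
  define N where "N = lq_norm q h g"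
  define P where "P = lq_norm q h f"
  have N: "0 < N" and P: "0 \<le> P"
    using False lq_norm_nonneg[of q h] by (auto simp: N_def P_def less_eq_real_def)
  \<comment> \<open>The sign comes from the embedding: C times this quantity dominates N >
    0.\<close>
  have Xpos: "0 \<le> X_norm \<theta> h g"
  proof (rule ccontr)
    assume "\<not> 0 \<le> X_norm \<theta> h g"
    hence "C * X_norm \<theta> h g < 0" using C by (simp add: mult_pos_neg)
    thus False using emb N by (simp add: N_def)
  qed
  have "N\<^sup>2 \<le> (C * X_norm \<theta> h g)\<^sup>2"
    using emb N by (intro power_mono) (auto simp: N_def)
  also have "\<dots> = C\<^sup>2 * (h * (\<Sum>i\<in>A. g i * frac_lap \<theta> h g i))"
    by (simp add: power_mult_distrib X_norm_power2[OF w A(1,3) Xpos])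
  finally have "N\<^sup>2 / C\<^sup>2 \<le> h * (\<Sum>i\<in>A. g i * frac_lap \<theta> h g i)"
    using C by (simp add: field_simps)
  hence "dt * (N\<^sup>2 / C\<^sup>2) \<le> dt * (h * (\<Sum>i\<in>A. g i * frac_lap \<theta> h g i))"
    using dt by (intro mult_left_mono) auto
  also have "\<dots> = (\<Sum>i\<in>A. h * (g i * (dt * frac_lap \<theta> h g i)))"
    by (simp add: sum_distrib_left mult_ac)
  also have "\<dots> = (\<Sum>i\<in>A. h * (g i * odd_powr (f i) (q - 1)) - h * \<bar>g i\<bar> powr q)"
  proof (rule sum.cong)
    fix i assume "i \<in> A"
    have "dt * frac_lap \<theta> h g i = odd_powr (f i) (q - 1) - odd_powr (g i) (q - 1)"
      using eq[OF \<open>i \<in> A\<close>] dt by (simp add: field_simps)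
    moreover have "g i * odd_powr (g i) (q - 1) = \<bar>g i\<bar> powr q"
    proof (cases "g i = 0")
      case False
      have "g i * odd_powr (g i) (q - 1) = \<bar>g i\<bar> powr (q - 2) * \<bar>g i\<bar> powr 2"
        using False by (simp add: odd_powr_def power2_eq_square)
      also have "\<dots> = \<bar>g i\<bar> powr q" by (subst powr_add[symmetric]) simp
      finally show ?thesis .
    qed (simp add: odd_powr_def)
    ultimately show "h * (g i * (dt * frac_lap \<theta> h g i))
        = h * (g i * odd_powr (f i) (q - 1)) - h * \<bar>g i\<bar> powr q"
      by (simp add: right_diff_distrib)
  qed simp
  also have "\<dots> = (\<Sum>i\<in>A. h * (g i * odd_powr (f i) (q - 1))) - N powr q"
    using lq_norm_powr[of q h A g] q h A by (simp add: sum_subtractf N_def)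
  \<comment> \<open>The mesh weight is split as h = h^((q-1)/q) h^(1/q) to match the two Hoelder
    factors.\<close>
  also have "(\<Sum>i\<in>A. h * (g i * odd_powr (f i) (q - 1)))
      \<le> (\<Sum>i\<in>A. (h * \<bar>f i\<bar> powr q) powr ((q - 1) / q) * (h * \<bar>g i\<bar> powr q) powr (1 / q))"
  proof (rule sum_mono)
    fix i
    have "g i * odd_powr (f i) (q - 1) \<le> \<bar>g i * odd_powr (f i) (q - 1)\<bar>"
      by (rule abs_ge_self)
    hence "g i * odd_powr (f i) (q - 1) \<le> \<bar>f i\<bar> powr (q - 1) * \<bar>g i\<bar>"
      by (simp add: abs_mult abs_odd_powr mult.commute)
    hence "h * (g i * odd_powr (f i) (q - 1)) \<le> h * (\<bar>f i\<bar> powr (q - 1) * \<bar>g i\<bar>)"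
      using h by (intro mult_left_mono) auto
    also have "\<dots> = (h powr ((q - 1) / q) * h powr (1 / q)) * (\<bar>f i\<bar> powr (q - 1) * \<bar>g i\<bar>)"
      using q h by (simp flip: powr_add add_divide_distrib)
    also have "\<dots> = (h * \<bar>f i\<bar> powr q) powr ((q - 1) / q) * (h * \<bar>g i\<bar> powr q) powr (1 / q)"
      using q h by (simp add: powr_mult powr_powr)
    finally show "h * (g i * odd_powr (f i) (q - 1))
        \<le> (h * \<bar>f i\<bar> powr q) powr ((q - 1) / q) * (h * \<bar>g i\<bar> powr q) powr (1 / q)" .
  qed
  also have "\<dots> \<le> (\<Sum>i\<in>A. h * \<bar>f i\<bar> powr q) powr ((q - 1) / q)
      * (\<Sum>i\<in>A. h * \<bar>g i\<bar> powr q) powr (1 / q)"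
    using q h A by (intro Holder_sum_powr) (auto simp: field_simps)
  also have "\<dots> = (P powr q) powr ((q - 1) / q) * (N powr q) powr (1 / q)"
    using q h A by (simp add: P_def N_def lq_norm_powr[of q h A])
  also have "\<dots> = P powr (q - 1) * N"
    using q N P by (simp add: powr_powr)
  finally have "dt * (N\<^sup>2 / C\<^sup>2) + N powr q \<le> P powr (q - 1) * N" by simp
  moreover have "N powr q = N powr (q - 1) * N"
    using N powr_add[of N "q - 1" 1] by simp
  ultimately have "(N powr (q - 1) + dt / C\<^sup>2 * N) * N \<le> P powr (q - 1) * N"
    by (simp add: power2_eq_square distrib_right add.commute)
  thus ?thesis using N by (simp add: N_def P_def)
qed

section \<open>The scalar decay law: exact solution and implicit Euler recursion\<close>

text \<open>Along (N^(q-1))' = -N/C^2 the power N^(q-2) is affine in time. Writing everything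
  through q - 2 treats q < 2 and q > 2 by one formula.\<close>

lemma decay_bound_eq:
  "decay_bound q C N s =
     max (N powr (q - 2) - (q - 2) / (q - 1) / C\<^sup>2 * s) 0 powr (1 / (q - 2))"
proof -
  have "- (2 - q) = q - 2" "- 1 / (2 - q) = 1 / (q - 2)"
    by (simp, metis minus_diff_eq minus_divide_divide minus_minus)
  moreover have "(2 - q) / (q - 1) * inverse (C\<^sup>2) * s = - ((q - 2) / (q - 1) / C\<^sup>2 * s)"
    by (simp add: divide_inverse algebra_simps)
  ultimately show ?thesis by (simp add: decay_bound_def)
qed

lemma decay_bound_nonneg: "0 \<le> decay_bound q C N s"
  by (simp add: decay_bound_def)

lemma decay_bound_0:
  assumes "q \<noteq> 2" "0 < N"
  shows "decay_bound q C N 0 = N"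
  using assms by (simp add: decay_bound_eq powr_powr)

lemma decay_bound_le:
  assumes "1 < q" "q \<noteq> 2" "0 < N" "0 \<le> s"
  shows "decay_bound q C N s \<le> N"
proof -
  have "decay_bound q C N s \<le> (N powr (q - 2)) powr (1 / (q - 2))"
  proof (cases "q > 2")
    case True
    thus ?thesis unfolding decay_bound_eq
      using assms by (intro powr_mono2) auto
  next
    case False
    hence "(q - 2) / (q - 1) / C\<^sup>2 * s \<le> 0"
      using assms by (intro mult_nonpos_nonneg divide_nonpos_nonneg divide_nonpos_pos) auto
    hence "N powr (q - 2) \<le> max (N powr (q - 2) - (q - 2) / (q - 1) / C\<^sup>2 * s) 0"
      by linarith
    thus ?thesis unfolding decay_bound_eq
      using assms False by (intro powr_mono2') auto
  qed
  thus ?thesis using assms by (simp add: powr_powr)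
qed

text \<open>With x the affine base at time s and r = (q-1)/(q-2), the solution is x^(r-1) and its
  power q - 1 is x^r while x > 0. Since r < 0 for q < 2 and r > 1 for q > 2, x^r is convex in both
  ranges, and r \<kappa> = 1/C^2 identifies the tangent slope in time as -D/C^2.\<close>

lemma decay_bound_step:
  assumes q: "1 < q" "q \<noteq> 2" and C: "0 < C" and N: "0 < N" and s: "0 \<le> s" "0 \<le> dt"
  shows "decay_bound q C N s powr (q - 1) - dt / C\<^sup>2 * decay_bound q C N s
           \<le> decay_bound q C N (s + dt) powr (q - 1)"
proof -
  define \<kappa> where "\<kappa> = (q - 2) / (q - 1) / C\<^sup>2"
  define r where "r = (q - 1) / (q - 2)"
  define x where "x = N powr (q - 2) - \<kappa> * s"
  define y where "y = N powr (q - 2) - \<kappa> * (s + dt)"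
  have r: "r - 1 = 1 / (q - 2)" "r * \<kappa> = 1 / C\<^sup>2" "1 / (q - 2) * (q - 1) = r"
  proof -
    have "q - 1 \<noteq> 0" "q - 2 \<noteq> 0" using q by auto
    thus "r * \<kappa> = 1 / C\<^sup>2" "1 / (q - 2) * (q - 1) = r"
      by (simp_all add: r_def \<kappa>_def)
    show "r - 1 = 1 / (q - 2)"
      using q by (simp add: r_def field_simps)
  qed
  have r': "r \<le> 0 \<or> 1 \<le> r" using q by (cases "q < 2") (auto simp: r_def divide_nonneg_neg)
  have yx: "y - x = - (\<kappa> * dt)" by (simp add: x_def y_def algebra_simps)
  have D: "decay_bound q C N s = max x 0 powr (r - 1)"
      "decay_bound q C N s powr (q - 1) = max x 0 powr r"
      "decay_bound q C N (s + dt) powr (q - 1) = max y 0 powr r"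
    unfolding decay_bound_eq \<kappa>_def[symmetric] x_def[symmetric] y_def[symmetric]
    by (simp_all only: r powr_powr)
  consider "x \<le> 0" | "0 < x" "0 < y" | "0 < x" "y \<le> 0" by linarith
  thus ?thesis
  proof cases
    case 1
    thus ?thesis unfolding D(2,3) unfolding D(1) by simp
  next
    case 2
    have "x powr r + r * x powr (r - 1) * (y - x) = x powr r - r * \<kappa> * dt * x powr (r - 1)"
      by (simp add: yx algebra_simps)
    also have "\<dots> = x powr r - dt / C\<^sup>2 * x powr (r - 1)"
      unfolding r(2) by simp
    finally show ?thesis
      using powr_above_tangent[OF r' 2] 2 unfolding D(2,3) unfolding D(1) by simp
  next
    \<comment> \<open>Extinction occurs within the step, so the right-hand side is 0. This forces
      \<kappa> > 0 and r \<ge> 1, and x \<le> \<kappa> dt \<le> r \<kappa> dt = dt/C^2 makes the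
      left-hand side nonpositive.\<close>
    case 3
    hence "0 < \<kappa> * dt" using yx by linarith
    hence "0 < \<kappa>" using s(2) by (simp add: zero_less_mult_iff)
    hence "1 \<le> r" using r' r(2) C by (smt (verit) mult_nonpos_nonneg zero_less_divide_iff zero_less_power)
    hence "x \<le> r * (\<kappa> * dt)"
      using yx 3 \<open>0 < \<kappa> * dt\<close> by (smt (verit) mult_le_cancel_right1)
    also have "\<dots> = dt / C\<^sup>2" using r(2) by (simp flip: mult.assoc)
    finally have "x * x powr (r - 1) \<le> dt / C\<^sup>2 * x powr (r - 1)"
      by (intro mult_right_mono) auto
    moreover have "x * x powr (r - 1) = x powr r"
      using 3 powr_add[of x 1 "r - 1"] by simp
    ultimately show ?thesis using 3 unfolding D(2,3) unfolding D(1) by simp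
  qed
qed

text \<open>The truncation errors of the implicit Euler recursion telescope, so the error bound holds
  with one constant for all times, beyond extinction as well.\<close>
lemma implicit_Euler_decay:
  fixes a :: "nat \<Rightarrow> real"
  assumes q: "1 < q" "q \<noteq> 2" and C: "0 < C" and N: "0 < N" and dt: "0 < dt"
    and a0: "a 0 = N" and a: "\<And>n. 0 \<le> a n"
    and step: "\<And>n. a (Suc n) powr (q - 1) + dt / C\<^sup>2 * a (Suc n) \<le> a n powr (q - 1)"
  shows "a n powr (q - 1) \<le> decay_bound q C N (real n * dt) powr (q - 1) + dt / C\<^sup>2 * N"
proof -
  define D where "D n = decay_bound q C N (real n * dt)" for n
  have c: "0 < dt / C\<^sup>2" using dt C by simp
  have DN: "0 \<le> dt / C\<^sup>2 * (N - D n)" for n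
    using decay_bound_le[of q N "real n * dt" C] q N dt c unfolding D_def
    by (intro mult_nonneg_nonneg) auto
  \<comment> \<open>The induction carries N - D n instead of N, because by
    \<open>decay_bound_step\<close> one step adds an error of at most dt/C^2 (D n - D (n+1)). If the
    new iterate exceeds D (n+1), it may be replaced by D (n+1) in the implicit term; otherwise the
    claim is immediate.\<close>
  have "a n powr (q - 1) \<le> D n powr (q - 1) + dt / C\<^sup>2 * (N - D n)"
  proof (induction n)
    case 0
    show ?case using q N by (simp add: a0 D_def decay_bound_0)
  next
    case (Suc n)
    show ?case
    proof (cases "a (Suc n) \<le> D (Suc n)")
      case True
      hence "a (Suc n) powr (q - 1) \<le> D (Suc n) powr (q - 1)"
        using a q by (intro powr_mono2) auto
      thus ?thesis using DN[of "Suc n"] by linarith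
    next
      case False
      hence "dt / C\<^sup>2 * D (Suc n) \<le> dt / C\<^sup>2 * a (Suc n)"
        using c by (intro mult_left_mono) auto
      moreover have "D n powr (q - 1) - dt / C\<^sup>2 * D n \<le> D (Suc n) powr (q - 1)"
        using decay_bound_step[of q C N "real n * dt" dt] q C N dt
        by (simp add: D_def algebra_simps)
      ultimately show ?thesis
        using Suc.IH step[of n] unfolding right_diff_distrib by linarith
    qed
  qed
  also have "\<dots> \<le> D n powr (q - 1) + dt / C\<^sup>2 * N"
    using decay_bound_nonneg[of q C N "real n * dt"] c
    by (intro add_left_mono mult_left_mono) (auto simp: D_def)
  finally show ?thesis by (simp add: D_def)
qed

text \<open>The error estimate for the powers q - 1 is carried to the values by uniform continuity
  of the root on a compact interval. Only the bound K on the initial value enters, so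
  \<open>dt0\<close> serves all sequences at once.\<close>

lemma implicit_Euler_uniform:
  fixes q C K \<epsilon> :: real
  assumes q: "1 < q" "q \<noteq> 2" and C: "0 < C" and \<epsilon>: "0 < \<epsilon>"
  obtains dt0 where "0 < dt0"
    "\<And>a dt n. \<lbrakk>0 < dt; dt < dt0; 0 < a 0; a 0 \<le> K; \<And>n. 0 \<le> a n;
        \<And>n. a (Suc n) powr (q - 1) + dt / C\<^sup>2 * a (Suc n) \<le> a n powr (q - 1)\<rbrakk>
      \<Longrightarrow> a n \<le> decay_bound q C (a 0) (real n * dt) + \<epsilon>"
proof -
  let ?S = "{0..K powr (q - 1) + 1}"
  have "uniformly_continuous_on ?S (\<lambda>x. x powr (1 / (q - 1)))"
    using q by (intro compact_uniformly_continuous continuous_on_powr' continuous_intros) auto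
  then obtain d where d: "0 < d" "\<And>x y. x \<in> ?S \<Longrightarrow> y \<in> ?S \<Longrightarrow> dist y x < d \<Longrightarrow>
      dist (y powr (1 / (q - 1))) (x powr (1 / (q - 1))) < \<epsilon>"
    using \<epsilon> unfolding uniformly_continuous_on_def by meson
  \<comment> \<open>m \<le> 1 keeps the perturbed value inside \<open>?S\<close>, and m \<le> d
    makes uniform continuity applicable. In \<open>dt0\<close>, |K| + 1 is a positive bound for a 0,
    so that the error dt/C^2 a 0 stays below m.\<close>
  define m where "m = min d 1"
  have m: "0 < m" "m \<le> d" "m \<le> 1" using d by (auto simp: m_def)
  define dt0 where "dt0 = m * C\<^sup>2 / (\<bar>K\<bar> + 1)"
  show ?thesis
  proof (rule that)
    show "0 < dt0" using m C by (simp add: dt0_def)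
  next
    fix a :: "nat \<Rightarrow> real" and dt n
    assume dt: "0 < dt" "dt < dt0" and a0: "0 < a 0" "a 0 \<le> K" and a: "\<And>n. 0 \<le> a n"
      and step: "\<And>n. a (Suc n) powr (q - 1) + dt / C\<^sup>2 * a (Suc n) \<le> a n powr (q - 1)"
    define D where "D = decay_bound q C (a 0) (real n * dt)"
    define V where "V = D powr (q - 1)"
    define \<eta> where "\<eta> = dt / C\<^sup>2 * a 0"
    have D: "0 \<le> D" "D \<le> K"
      using decay_bound_nonneg[of q C "a 0" "real n * dt"]
        decay_bound_le[of q "a 0" "real n * dt" C] q dt a0 by (auto simp: D_def)
    have "\<eta> \<le> dt / C\<^sup>2 * (\<bar>K\<bar> + 1)"
      using a0 dt unfolding \<eta>_def by (intro mult_left_mono) auto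
    also have "\<dots> < m"
      using dt(2) C by (simp add: dt0_def field_simps)
    finally have "\<eta> < m" .
    hence \<eta>: "0 < \<eta>" "\<eta> < d" "\<eta> < 1"
      using dt C a0 m(2,3) by (simp add: \<eta>_def, linarith+)
    have V: "0 \<le> V" "V \<le> K powr (q - 1)"
      using D q by (auto simp: V_def intro: powr_mono2)
    have "a n = (a n powr (q - 1)) powr (1 / (q - 1))"
      using a[of n] q by (simp add: powr_powr)
    also have "\<dots> \<le> (V + \<eta>) powr (1 / (q - 1))"
      using implicit_Euler_decay[where a = a, OF q C a0(1) dt(1) refl a step, of n] q
      by (intro powr_mono2) (auto simp: V_def D_def \<eta>_def)
    also have "\<dots> < V powr (1 / (q - 1)) + \<epsilon>"
      using d(2)[of V "V + \<eta>"] V \<eta> by (simp add: dist_real_def)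
    also have "V powr (1 / (q - 1)) = D"
      using D q by (simp add: V_def powr_powr)
    finally show "a n \<le> decay_bound q C (a 0) (real n * dt) + \<epsilon>"
      by (simp add: D_def)
  qed
qed

lemma implicit_Euler_superexponential:
  fixes a :: "nat \<Rightarrow> real"
  assumes q: "2 < q" and C: "0 < C" and N: "0 < a 0" and dt: "0 < dt" and n: "0 < n"
    and a: "\<And>n. 0 \<le> a n"
    and step: "\<And>n. a (Suc n) powr (q - 1) + dt / C\<^sup>2 * a (Suc n) \<le> a n powr (q - 1)"
  shows "a n \<le> a 0 * (ext_time q C (a 0) / (real n * dt)) powr (real n / 2)"
proof (cases "a n = 0")
  case True
  thus ?thesis using N by simp
next
  case False
  \<comment> \<open>This exponent turns a^(q-1), which the recursion controls, into a^(q-2); it lies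
    in (0, 1), hence concavity.\<close>
  define \<rho> where "\<rho> = (q - 2) / (q - 1)"
  have \<rho>: "0 < \<rho>" "\<rho> < 1" "\<rho> * (q - 1) = q - 2" "(\<rho> - 1) * (q - 1) = - 1"
    using q by (auto simp: \<rho>_def field_simps)
  have "a (Suc k) \<le> a k" for k
  proof -
    have "0 \<le> dt / C\<^sup>2 * a (Suc k)" using dt a by simp
    hence "a (Suc k) powr (q - 1) \<le> a k powr (q - 1)" using step[of k] by linarith
    thus ?thesis using a q powr_less_mono2[of "q - 1" "a k" "a (Suc k)"] by fastforce
  qed
  hence mono: "a j \<le> a i" if "i \<le> j" for i j
    using that lift_Suc_antimono_le[of a] by blast
  have pos: "0 < a k" if "k \<le> n" for k
    using mono[OF that] a[of n] False by linarith
  \<comment> \<open>The tangent at a_k^(q-1) has slope \<rho>/a_k because (\<rho> - 1)(q - 1) = -1;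
    this is the source of the ratio of consecutive iterates.\<close>
  have diff: "\<rho> / C\<^sup>2 * dt * (a (Suc k) / a k) \<le> a k powr (q - 2) - a (Suc k) powr (q - 2)"
    if "k < n" for k
  proof -
    have p: "0 < a k" "0 < a (Suc k)" using pos that by auto
    let ?x = "a k powr (q - 1)" and ?y = "a (Suc k) powr (q - 1)"
    have "dt / C\<^sup>2 * a (Suc k) \<le> ?x - ?y" using step[of k] by linarith
    hence "\<rho> * ?x powr (\<rho> - 1) * (dt / C\<^sup>2 * a (Suc k)) \<le> \<rho> * ?x powr (\<rho> - 1) * (?x - ?y)"
      using \<rho> by (intro mult_left_mono) auto
    also have "\<dots> \<le> ?x powr \<rho> - ?y powr \<rho>"
      using powr_below_tangent[of \<rho> ?x ?y] \<rho> p by (simp add: algebra_simps)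
    finally show ?thesis
      using p by (simp add: powr_powr mult.commute[of "q - 1"] \<rho> powr_minus divide_inverse mult_ac)
  qed
  have "\<rho> / C\<^sup>2 * dt * (\<Sum>k<n. a (Suc k) / a k)
      \<le> (\<Sum>k<n. a k powr (q - 2) - a (Suc k) powr (q - 2))"
    unfolding sum_distrib_left using diff by (intro sum_mono) auto
  also have "\<dots> \<le> a 0 powr (q - 2)"
    using sum_lessThan_telescope'[of "\<lambda>k. a k powr (q - 2)" n] by simp
  finally have "(\<Sum>k<n. a (Suc k) / a k) \<le> a 0 powr (q - 2) / (\<rho> / C\<^sup>2 * dt)"
    using \<rho>(1) dt C by (subst pos_le_divide_eq) (simp_all add: mult.commute)
  hence "(\<Sum>k<n. a (Suc k) / a k) / n \<le> a 0 powr (q - 2) / (\<rho> / C\<^sup>2 * dt) / n"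
    by (rule divide_right_mono) simp
  also have "\<dots> = ext_time q C (a 0) / (real n * dt)"
    by (simp add: ext_time_def \<rho>_def mult_ac)
  finally have sum: "(\<Sum>k<n. a (Suc k) / a k) / n \<le> ext_time q C (a 0) / (real n * dt)" .
  define x where "x = ext_time q C (a 0) / (real n * dt)"
  have "(\<Prod>k<n. a (Suc k) / a k) powr (1 / card {..<n}) \<le> (\<Sum>k<n. a (Suc k) / a k / card {..<n})"
    using n a by (intro arith_geom_mean) auto
  also have "(\<Prod>k<n. a (Suc k) / a k) = a n / a 0"
  proof -
    have "m \<le> n \<Longrightarrow> (\<Prod>k<m. a (Suc k) / a k) = a m / a 0" for m
    proof (induction m)
      case (Suc m)
      thus ?case using pos[of m] by simp
    qed (use N in simp)
    thus ?thesis by simp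
  qed
  also have "(\<Sum>k<n. a (Suc k) / a k / card {..<n}) \<le> x"
    using sum by (simp add: sum_divide_distrib x_def)
  finally have "(a n / a 0) powr (1 / n) \<le> x" by simp
  hence "((a n / a 0) powr (1 / n)) powr n \<le> x powr n"
    by (intro powr_mono2) auto
  hence xn: "a n / a 0 \<le> x powr n"
    using n a[of n] N by (simp add: powr_powr)
  have "0 < x" using q C N n dt by (simp add: x_def ext_time_def)
  \<comment> \<open>Halving the exponent weakens the bound only when x \<le> 1. For x > 1 the
    right-hand side is at least 1 and monotonicity of the iterates suffices.\<close>
  have "a n / a 0 \<le> x powr (n / 2)"
  proof (cases "x \<le> 1")
    case True
    hence "x powr n \<le> x powr (n / 2)"
      using \<open>0 < x\<close> by (intro powr_mono') auto
    thus ?thesis using xn by linarith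
  next
    case False
    have "a n / a 0 \<le> 1" using mono[of 0 n] N by simp
    also have "1 \<le> x powr (n / 2)" using False by (intro ge_one_powr_ge_zero) auto
    finally show ?thesis .
  qed
  thus ?thesis using N by (simp add: x_def field_simps)
qed

section \<open>Limits under refinement and bounds uniform in the mesh\<close>

lemma tendsto_decay_bound:
  assumes q: "1 < q" "q \<noteq> 2" and C: "0 < C" and N: "0 < N" and t: "0 \<le> t"
    and f: "(f \<longlongrightarrow> N) F" and g: "(g \<longlongrightarrow> t) F"
  shows "((\<lambda>x. decay_bound q C (f x) (g x)) \<longlongrightarrow> decay_bound q C N t) F"
proof -
  have "max (N powr (q - 2) - (q - 2) / (q - 1) / C\<^sup>2 * t) 0 \<noteq> 0 \<or> 0 < 1 / (q - 2)"
  proof (cases "2 < q")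
    case False
    hence "(q - 2) / (q - 1) / C\<^sup>2 * t \<le> 0"
      using q t by (intro mult_nonpos_nonneg divide_nonpos_nonneg divide_nonpos_pos) auto
    moreover have "0 < N powr (q - 2)" using N by simp
    ultimately show ?thesis by linarith
  qed auto
  thus ?thesis
    unfolding decay_bound_eq using N
    by (intro tendsto_powr' tendsto_max tendsto_intros f g) auto
qed

lemma refinement_filter_tendsto:
  shows "filterlim (\<lambda>x. fst (snd x)) (at 0 within {h. admissible L h}) (refinement_filter L t)"
    and "((\<lambda>x. fst (snd (snd x))) \<longlongrightarrow> 0) (refinement_filter L t)"
    and "((\<lambda>x. real (snd (snd (snd x))) * fst x) \<longlongrightarrow> t) (refinement_filter L t)"
proof -
  have "((\<lambda>(dt, h, \<epsilon>, n). (dt, h, \<epsilon>, real n * dt)) \<longlongrightarrow> (0, 0, 0, t)) (refinement_filter L t)"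
    unfolding refinement_filter_def
    by (rule filterlim_mono[OF filterlim_filtercomap order_refl inf_le1])
  hence lim: "((\<lambda>x. (fst x, fst (snd x), fst (snd (snd x)), real (snd (snd (snd x))) * fst x))
      \<longlongrightarrow> (0, 0, 0, t)) (refinement_filter L t)"
    by (simp add: case_prod_beta')
  show "((\<lambda>x. fst (snd (snd x))) \<longlongrightarrow> 0) (refinement_filter L t)"
    and "((\<lambda>x. real (snd (snd (snd x))) * fst x) \<longlongrightarrow> t) (refinement_filter L t)"
    using tendsto_fst[OF tendsto_snd[OF tendsto_snd[OF lim]]]
      tendsto_snd[OF tendsto_snd[OF tendsto_snd[OF lim]]] by simp_all
  have "\<forall>\<^sub>F x in refinement_filter L t. admissible L (fst (snd x))"
    unfolding refinement_filter_def
    by (auto simp: eventually_inf_principal intro!: always_eventually)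
  \<comment> \<open>Admissible steps are positive, which upgrades convergence of h to 0 to the
    punctured filter.\<close>
  hence "\<forall>\<^sub>F x in refinement_filter L t. admissible L (fst (snd x)) \<and> fst (snd x) \<noteq> 0"
    by (rule eventually_mono) (auto simp: admissible_def)
  thus "filterlim (\<lambda>x. fst (snd x)) (at 0 within {h. admissible L h}) (refinement_filter L t)"
    using tendsto_fst[OF tendsto_snd[OF lim]] by (simp add: filterlim_at)
qed

lemma Lq_norm_pos:
  assumes "in_Lq q A U" "\<not> (AE x\<in>A in lebesgue. U x = 0)"
  shows "0 < Lq_norm q A U"
proof -
  have int: "integrable lebesgue (\<lambda>x. indicat_real A x *\<^sub>R \<bar>U x\<bar> powr q)"
    using assms(1) by (simp add: in_Lq_def set_integrable_def)
  have "(LINT x:A|lebesgue. \<bar>U x\<bar> powr q) \<noteq> 0"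
  proof
    assume "(LINT x:A|lebesgue. \<bar>U x\<bar> powr q) = 0"
    hence "AE x in lebesgue. indicat_real A x *\<^sub>R \<bar>U x\<bar> powr q = 0"
      using integral_nonneg_eq_0_iff_AE[OF int] by (simp add: set_lebesgue_integral_def)
    hence "AE x\<in>A in lebesgue. U x = 0"
      by eventually_elim (auto simp: indicator_def split: if_splits)
    thus False using assms(2) by contradiction
  qed
  thus ?thesis by (simp add: Lq_norm_def)
qed

text \<open>Convergence controls F only for small h. The remaining steps h \<ge> d have the form
  L/(M+1) with M \<le> L/d, so there are finitely many of them.\<close>

lemma admissible_bounded:
  fixes F :: "real \<Rightarrow> real"
  assumes L: "0 < L" and F: "(F \<longlongrightarrow> l) (at 0 within {h. admissible L h})"
  obtains K where "\<And>h. admissible L h \<Longrightarrow> F h \<le> K"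
proof -
  have "\<forall>\<^sub>F h in at 0 within {h. admissible L h}. F h < l + 1"
    using F by (rule order_tendstoD) simp
  then obtain d where d: "0 < d"
      "\<And>h. admissible L h \<Longrightarrow> h \<noteq> 0 \<Longrightarrow> dist h 0 < d \<Longrightarrow> F h < l + 1"
    unfolding eventually_at by auto
  have "{h. admissible L h \<and> d \<le> h} \<subseteq> (\<lambda>M. L / (real M + 1)) ` {..nat \<lceil>L / d\<rceil>}"
  proof safe
    fix h assume "admissible L h" "d \<le> h"
    then obtain M :: nat where M: "L = (real M + 1) * h" and h: "0 < h"
      by (auto simp: admissible_def)
    have "real M * d \<le> real M * h" using \<open>d \<le> h\<close> by (intro mult_left_mono) auto
    also have "\<dots> \<le> L" using M h by (simp add: algebra_simps)
    finally have "real M \<le> L / d" using d(1) by (simp add: field_simps)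
    hence "M \<le> nat \<lceil>L / d\<rceil>" by linarith
    moreover have "h = L / (real M + 1)" using M by (simp add: field_simps)
    ultimately show "h \<in> (\<lambda>M. L / (real M + 1)) ` {..nat \<lceil>L / d\<rceil>}" by blast
  qed
  hence fin: "finite {h. admissible L h \<and> d \<le> h}" by (rule finite_subset) simp
  show ?thesis
  proof (rule that)
    fix h assume h: "admissible L h"
    show "F h \<le> Max (insert (l + 1) (F ` {h. admissible L h \<and> d \<le> h}))"
    proof (cases "d \<le> h")
      case True
      thus ?thesis using fin h by (intro Max_ge) auto
    next
      case False
      have "0 < h" using h by (simp add: admissible_def)
      hence "F h < l + 1" using d(2)[OF h] False by simp
      also have "\<dots> \<le> Max (insert (l + 1) (F ` {h. admissible L h \<and> d \<le> h}))"
        using fin by (intro Max_ge) auto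
      finally show ?thesis by simp
    qed
  qed
qed

section \<open>From the scheme to the scalar recursion\<close>

text \<open>This supplies the hypotheses of the scalar lemmas for the sequence of norms. The initial
  iterate agrees with the datum everywhere, since both vanish off the mesh.\<close>

lemma scheme_solution_norm_decay:
  assumes "1 < q" "0 < C" "0 < dt" and h: "admissible L h"
    and u0: "v \<in> X_space L h" "v \<noteq> (\<lambda>_. 0)"
    and emb: "\<And>f. f \<in> X_space L h \<Longrightarrow> lq_norm q h f \<le> C * X_norm \<theta> h f"
    and sol: "scheme_solution \<theta> L q h dt v u"
  shows "lq_norm q h (u 0) = lq_norm q h v" and "0 < lq_norm q h v"
    and "lq_norm q h (u (Suc n)) powr (q - 1) + dt / C\<^sup>2 * lq_norm q h (u (Suc n))
           \<le> lq_norm q h (u n) powr (q - 1)"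
proof -
  define A where "A = {- int (mesh_num L h)..int (mesh_num L h)}"
  have A: "finite A" "i \<in> A \<longleftrightarrow> \<bar>i\<bar> \<le> int (mesh_num L h)" for i
    by (auto simp: A_def)
  have supp: "f i = 0" if "f \<in> X_space L h" "i \<notin> A" for f i
    using that by (auto simp: X_space_def A)
  have hpos: "0 < h" using h by (simp add: admissible_def)
  have u: "u m \<in> X_space L h" for m
    using sol by (auto simp: scheme_solution_def X_space_def)
  have "u 0 = v"
  proof
    fix i show "u 0 i = v i"
      using sol supp[OF u(1)] supp[OF u0(1)] A(2)[of i]
      by (cases "i \<in> A") (auto simp: scheme_solution_def)
  qed
  thus "lq_norm q h (u 0) = lq_norm q h v" by simp
  show "0 < lq_norm q h v"
    using assms(1) hpos A(1) supp[OF u0(1)] u0(2) by (intro lq_norm_pos) auto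
  \<comment> \<open>The unit vector at 0 lies in \<open>X_space L h\<close> for every mesh number,
    so the embedding applies to it.\<close>
  have "weight \<theta> h summable_on UNIV"
    using assms(1) hpos by (intro weight_summable[of q h C] emb) (auto simp: X_space_def)
  thus "lq_norm q h (u (Suc n)) powr (q - 1) + dt / C\<^sup>2 * lq_norm q h (u (Suc n))
          \<le> lq_norm q h (u n) powr (q - 1)"
    using sol by (intro norm_decay_step[OF assms(1) hpos assms(3,2) A(1) supp[OF u] supp[OF u] _ emb[OF u]])
      (auto simp: scheme_solution_def A)
qed

theorem proposition10:
  fixes \<theta> L q C :: real and u0 :: "real \<Rightarrow> int \<Rightarrow> real"
  assumes "0 < \<theta>" "\<theta> < 1" "L > 0"
    and "1 < q" "ereal q \<le> crit_exp \<theta>"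
    and "\<And>h. admissible L h \<Longrightarrow> u0 h \<in> X_space L h"
    and "\<And>h. admissible L h \<Longrightarrow> u0 h \<noteq> (\<lambda>_. 0)"
    and "\<exists>l. ((\<lambda>h. lq_norm q h (u0 h)) \<longlongrightarrow> l) (at 0 within {h. admissible L h})"
    and "C > 0"
    and "\<And>h f. admissible L h \<Longrightarrow> f \<in> X_space L h \<Longrightarrow> lq_norm q h f \<le> C * X_norm \<theta> h f"
  shows
    "(q \<noteq> 2 \<longrightarrow>
        (\<forall>\<epsilon>>0. \<exists>dt0>0. \<forall>h dt u. admissible L h \<and> 0 < dt \<and> dt < dt0 \<and>
            scheme_solution \<theta> L q h dt (u0 h) u \<longrightarrow>
            (\<forall>n. lq_norm q h (u n) \<le>
                   decay_bound q C (lq_norm q h (u0 h)) (real n * dt) + \<epsilon>)) \<and>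
        (\<forall>U. in_Lq q {-L<..<L} U \<and> \<not> (AE x\<in>{-L<..<L} in lebesgue. U x = 0) \<and>
            ((\<lambda>h. lq_norm q h (u0 h)) \<longlongrightarrow> Lq_norm q {-L<..<L} U)
              (at 0 within {h. admissible L h}) \<longrightarrow>
            (\<forall>t\<ge>0.
              ((\<lambda>(dt, h, \<epsilon>, n). decay_bound q C (lq_norm q h (u0 h)) (real n * dt) + \<epsilon>)
                 \<longlongrightarrow> decay_bound q C (Lq_norm q {-L<..<L} U) t)
              (refinement_filter L t)))) \<and>
     (q > 2 \<longrightarrow>
        (\<forall>h dt u. admissible L h \<and> 0 < dt \<and> scheme_solution \<theta> L q h dt (u0 h) u \<longrightarrow>
            (\<forall>n. lq_norm q h (u n) \<le>
                   lq_norm q h (u0 h) *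
                   (if n = 0 then 1
                    else (ext_time q C (lq_norm q h (u0 h)) / (real n * dt)) powr (real n / 2)))))"
proof (intro conjI impI allI)
  fix \<epsilon> :: real
  assume "q \<noteq> 2" "0 < \<epsilon>"
  \<comment> \<open>A single bound on all initial norms makes the time-step threshold independent of
    h.\<close>
  obtain K where K: "\<And>h. admissible L h \<Longrightarrow> lq_norm q h (u0 h) \<le> K"
    using assms(8) admissible_bounded[OF assms(3)] by metis
  obtain dt0 where dt0: "0 < dt0"
    "\<And>a dt n. \<lbrakk>0 < dt; dt < dt0; 0 < a 0; a 0 \<le> K; \<And>n. 0 \<le> a n;
        \<And>n. a (Suc n) powr (q - 1) + dt / C\<^sup>2 * a (Suc n) \<le> a n powr (q - 1)\<rbrakk>
      \<Longrightarrow> a n \<le> decay_bound q C (a 0) (real n * dt) + \<epsilon>"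
    using implicit_Euler_uniform[OF \<open>1 < q\<close> \<open>q \<noteq> 2\<close> \<open>C > 0\<close> \<open>0 < \<epsilon>\<close>] by metis
  show "\<exists>dt0>0. \<forall>h dt u. admissible L h \<and> 0 < dt \<and> dt < dt0 \<and>
            scheme_solution \<theta> L q h dt (u0 h) u \<longrightarrow>
            (\<forall>n. lq_norm q h (u n) \<le>
                   decay_bound q C (lq_norm q h (u0 h)) (real n * dt) + \<epsilon>)"
  proof (intro exI[of _ dt0] conjI allI impI dt0(1), elim conjE)
    fix h dt u n
    assume h: "admissible L h" and dt: "0 < dt" "dt < dt0"
      and sol: "scheme_solution \<theta> L q h dt (u0 h) u"
    note * = scheme_solution_norm_decay[OF assms(4,9) dt(1) h assms(6,7,10)[OF h] sol]
    show "lq_norm q h (u n) \<le> decay_bound q C (lq_norm q h (u0 h)) (real n * dt) + \<epsilon>"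
      using dt0(2)[of dt "\<lambda>n. lq_norm q h (u n)" n] dt K[OF h] * by (simp add: lq_norm_nonneg)
  qed
next
  fix U t
  assume "q \<noteq> 2" and U: "in_Lq q {-L<..<L} U \<and> \<not> (AE x\<in>{-L<..<L} in lebesgue. U x = 0) \<and>
            ((\<lambda>h. lq_norm q h (u0 h)) \<longlongrightarrow> Lq_norm q {-L<..<L} U) (at 0 within {h. admissible L h})"
    and "0 \<le> (t :: real)"
  note lim = refinement_filter_tendsto[where L = L and t = t]
  have "0 < Lq_norm q {-L<..<L} U" using U by (intro Lq_norm_pos) auto
  \<comment> \<open>The data norms converge in h alone; composing with the h-coordinate transfers
    this to the filter on tuples.\<close>
  moreover have "((\<lambda>x. lq_norm q (fst (snd x)) (u0 (fst (snd x)))) \<longlongrightarrow> Lq_norm q {-L<..<L} U)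
      (refinement_filter L t)"
    using U by (intro filterlim_compose[OF _ lim(1), of "\<lambda>h. lq_norm q h (u0 h)"]) auto
  ultimately have "((\<lambda>x. decay_bound q C (lq_norm q (fst (snd x)) (u0 (fst (snd x))))
        (real (snd (snd (snd x))) * fst x)) \<longlongrightarrow> decay_bound q C (Lq_norm q {-L<..<L} U) t)
      (refinement_filter L t)"
    using assms(4,9) \<open>q \<noteq> 2\<close> \<open>0 \<le> t\<close> lim(3) by (intro tendsto_decay_bound) auto
  from tendsto_add[OF this lim(2)]
  show "((\<lambda>(dt, h, \<epsilon>, n). decay_bound q C (lq_norm q h (u0 h)) (real n * dt) + \<epsilon>)
                 \<longlongrightarrow> decay_bound q C (Lq_norm q {-L<..<L} U) t) (refinement_filter L t)"
    by (simp add: case_prod_beta')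
next
  fix h dt u n
  assume q: "2 < q" and "admissible L h \<and> 0 < dt \<and> scheme_solution \<theta> L q h dt (u0 h) u"
  hence h: "admissible L h" and dt: "0 < dt" and sol: "scheme_solution \<theta> L q h dt (u0 h) u"
    by auto
  note * = scheme_solution_norm_decay[OF assms(4,9) dt h assms(6,7,10)[OF h] sol]
  show "lq_norm q h (u n) \<le> lq_norm q h (u0 h) *
          (if n = 0 then 1
           else (ext_time q C (lq_norm q h (u0 h)) / (real n * dt)) powr (real n / 2))"
    using implicit_Euler_superexponential[of q C "\<lambda>n. lq_norm q h (u n)" dt n] q assms(9) dt *
    by (cases "n = 0") (simp_all add: lq_norm_nonneg)
qed

end
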